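(* Let $G$ be a graph on $n \geq 3$ vertices such that $G$ and its complement $\overline{G}$ are both connected. Then $$b_{\rm g}(G)\, b_{\rm g}(\overline{G}) \leq n+18.$$
   Context: All graphs are finite, simple and undirected. The burning game on a graph $G$ is played by two players, Burner and Staller, in rounds $t=1,2,3,\dots$. Initially (round $0$) all vertices are unburned. Each round $t\ge 1$ consists of two phases: first, in the spreading phase, every unburned vertex having a burning neighbor starts to burn (fire spreads simultaneously, by distance one, from all burning vertices); then, in the selection phase, if unburned vertices remain, the player whose turn it is chooses one unburned vertex, which starts to burn. Burning vertices stay burning forever. The players alternate: one of them selects in the odd rounds, the other in the even rounds. The game ends in the first round in which all vertices of $G$ are burning (possibly already after the spreading phase of that round). Burner wants to minimize the number of rounds and Staller wants to maximize it. If both play optimally, the number of rounds is denoted $b_{\rm g}(G)$ (the game burning number) when Burner makes the first move (selects in round 1). *)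

theory Defs
  imports "Graph_Theory.Digraph_Component"
begin

text \<open>A finite simple undirected graph is a \<^locale>\<open>pair_graph\<close>: a finite symmetric loop-free
  set of ordered pairs, in which the edge uv is represented by both (u, v) and (v, u).\<close>

definition complement_graph :: "'a pair_pre_digraph \<Rightarrow> 'a pair_pre_digraph" where
  "complement_graph G =
     \<lparr>pverts = pverts G,
      parcs = {(u, v). u \<in> pverts G \<and> v \<in> pverts G \<and> u \<noteq> v \<and> (u, v) \<notin> parcs G}\<rparr>"

lemma pair_graph_complement_graph:
  assumes "pair_graph G"
  shows "pair_graph (complement_graph G)"
proof -
  interpret pair_graph G by (rule assms)
  have sym_G: "(v, u) \<in> parcs G" if "(u, v) \<in> parcs G" for u v
    using that pair_sym_arcs by (auto simp: symmetric_def arcs_ends_def arc_to_ends_def sym_def)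
  have "finite (pverts G \<times> pverts G)"
    by simp
  then have "finite (parcs (complement_graph G))"
    by (rule rev_finite_subset) (auto simp: complement_graph_def)
  then show ?thesis
    by unfold_locales (auto simp: complement_graph_def symmetric_def sym_def dest: sym_G)
qed

datatype player = Burner | Staller

fun opponent :: "player \<Rightarrow> player" where
  "opponent Burner = Staller"
| "opponent Staller = Burner"

definition spread :: "'a pair_pre_digraph \<Rightarrow> 'a set \<Rightarrow> 'a set" where
  "spread G B = B \<union> {v \<in> pverts G. \<exists>u\<in>B. (u, v) \<in> parcs G}"

text \<open>The minimax value of a position: \<open>rounds_left G p B\<close> is the number of further rounds under
  optimal play if at the end of a round the set of burning vertices is \<open>B\<close> and \<open>p\<close> is the player
  to select in the next round. The value 0 for infinite graphs is a dummy value.\<close>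

function rounds_left :: "'a pair_pre_digraph \<Rightarrow> player \<Rightarrow> 'a set \<Rightarrow> nat" where
  "rounds_left G p B =
    (if infinite (pverts G) \<or> pverts G \<subseteq> B then 0
     else if pverts G \<subseteq> spread G B then 1
     else 1 + (case p of
         Burner \<Rightarrow>
           Min ((\<lambda>v. rounds_left G (opponent p) (insert v (spread G B))) ` (pverts G - spread G B))
       | Staller \<Rightarrow>
           Max ((\<lambda>v. rounds_left G (opponent p) (insert v (spread G B))) ` (pverts G - spread G B))))"
  by pat_completeness auto
termination
proof (relation "measure (\<lambda>(G, p, B). card (pverts G - B))", goal_cases)
  case 1
  show ?case by simp
next
  case (2 G p B v)
  then have "pverts G - insert v (spread G B) \<subset> pverts G - B"
    by (auto simp: spread_def)
  moreover have "finite (pverts G - B)"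
    using 2 by simp
  ultimately have "card (pverts G - insert v (spread G B)) < card (pverts G - B)"
    by (intro psubset_card_mono)
  then show ?case
    by (simp only: in_measure case_prod_conv)
next
  case (3 G p B v)
  then have "pverts G - insert v (spread G B) \<subset> pverts G - B"
    by (auto simp: spread_def)
  moreover have "finite (pverts G - B)"
    using 3 by simp
  ultimately have "card (pverts G - insert v (spread G B)) < card (pverts G - B)"
    by (intro psubset_card_mono)
  then show ?case
    by (simp only: in_measure case_prod_conv)
qed

declare rounds_left.simps [simp del]

definition game_burning_number :: "'a pair_pre_digraph \<Rightarrow> nat" where
  "game_burning_number G = rounds_left G Burner {}"

end

theory Submission
  imports Defs
begin

text \<open>If some \<open>x\<close>, \<open>y\<close> are at distance at least 3 in a graph, then every vertex is within distance 2
  of \<open>x\<close> in the complement, since no vertex is adjacent to both \<open>x\<close> and \<open>y\<close>. Hence \<open>G\<close> or its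
  complement is covered by a ball of radius 2, and its game burning number is at most 3 (Burner
  plays the centre). It remains to bound the other number by \<open>k = n div 3 + 6\<close>. Burner can make sure
  that vertices \<open>w\<^sub>1\<close>, \<open>w\<^sub>2\<close>, \<open>w\<^sub>3\<close> burn by rounds 1, 3, 5, so \<open>k\<close> rounds suffice if the balls of
  radii \<open>k - 1\<close>, \<open>k - 3\<close>, \<open>k - 5\<close> about them cover the graph. Such a cover exists: in a
  breadth-first search tree, the ball of radius \<open>r\<close> about the ancestor \<open>r\<close> levels above a deepest
  vertex contains the whole subtree below that ancestor, which has more than \<open>r\<close> vertices and can
  be cut off.\<close>

section \<open>Spreading\<close>

lemma spread_mono: "A \<subseteq> B \<Longrightarrow> spread G A \<subseteq> spread G B"
  by (auto simp: spread_def)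

lemma subset_spread: "B \<subseteq> spread G B"
  by (auto simp: spread_def)

lemma spread_power_mono: "A \<subseteq> B \<Longrightarrow> (spread G ^^ k) A \<subseteq> (spread G ^^ k) B"
  by (induction k) (auto dest: spread_mono)

lemma subset_spread_power: "B \<subseteq> (spread G ^^ k) B"
  by (induction k) (use subset_spread in fastforce)+

lemma spread_power_le:
  assumes "i \<le> j"
  shows "(spread G ^^ i) B \<subseteq> (spread G ^^ j) B"
proof -
  have "(spread G ^^ i) B \<subseteq> (spread G ^^ (j - i)) ((spread G ^^ i) B)"
    by (rule subset_spread_power)
  also have "\<dots> = (spread G ^^ j) B"
    using assms by (simp flip: funpow_add comp_apply[of "spread G ^^ _"])
  finally show ?thesis .
qed

section \<open>Upper bounds for the game\<close>

lemma rounds_left_all_burning: "pverts G \<subseteq> B \<Longrightarrow> rounds_left G p B = 0"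
  by (simp add: rounds_left.simps)

lemma rounds_left_Staller_le:
  assumes "\<And>v. v \<in> pverts G - spread G B \<Longrightarrow> rounds_left G Burner (insert v (spread G B)) \<le> k"
  shows "rounds_left G Staller B \<le> Suc k"
proof -
  let ?S = "pverts G - spread G B"
  have "Max ((\<lambda>v. rounds_left G Burner (insert v (spread G B))) ` ?S) \<le> k"
    if "finite (pverts G)" "?S \<noteq> {}"
    using that assms by (intro Max.boundedI) auto
  then show ?thesis
    by (subst rounds_left.simps) auto
qed

lemma rounds_left_Burner_le:
  assumes "v \<in> pverts G - spread G B" "rounds_left G Staller (insert v (spread G B)) \<le> k"
  shows "rounds_left G Burner B \<le> Suc k"
proof -
  let ?S = "pverts G - spread G B"
  have "Min ((\<lambda>v. rounds_left G Staller (insert v (spread G B))) ` ?S) \<le> k"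
    if "finite (pverts G)"
    using that assms by (intro Min.coboundedI[THEN order_trans]) auto
  then show ?thesis
    by (subst rounds_left.simps) auto
qed

lemma rounds_left_le_one: "pverts G \<subseteq> spread G B \<Longrightarrow> rounds_left G p B \<le> 1"
  by (subst rounds_left.simps) auto

text \<open>Spreading alone finishes the game within \<open>k\<close> rounds; a selected vertex only
  enlarges the burning set, so no choice of either player can delay this.\<close>

lemma rounds_left_le_of_spread_power:
  assumes "pverts G \<subseteq> (spread G ^^ k) B"
  shows "rounds_left G p B \<le> k"
  using assms
proof (induction k arbitrary: p B)
  case 0
  then show ?case by (simp add: rounds_left_all_burning)
next
  case (Suc k)
  have IH: "rounds_left G q (insert v (spread G B)) \<le> k" for q v
  proof (rule Suc.IH)
    have "pverts G \<subseteq> (spread G ^^ k) (spread G B)"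
      using Suc.prems by (simp add: funpow_swap1)
    also have "\<dots> \<subseteq> (spread G ^^ k) (insert v (spread G B))"
      by (rule spread_power_mono) auto
    finally show "pverts G \<subseteq> (spread G ^^ k) (insert v (spread G B))" .
  qed
  show ?case
  proof (cases "pverts G \<subseteq> spread G B")
    case True
    then show ?thesis using rounds_left_le_one[of G B p] by simp
  next
    case False
    then obtain v where "v \<in> pverts G - spread G B" by auto
    then show ?thesis
      by (cases p) (auto intro: rounds_left_Burner_le rounds_left_Staller_le IH)
  qed
qed

text \<open>Read \<open>U\<close> as the region that Burner covers by his later moves.\<close>

lemma rounds_left_le_add_ball:
  assumes later: "\<And>B. pverts G \<subseteq> (spread G ^^ k) B \<union> U \<Longrightarrow> rounds_left G Burner B \<le> k"
    and w: "w \<in> pverts G"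
    and cover: "pverts G \<subseteq> (spread G ^^ (k + 2)) B \<union> ((spread G ^^ (k + 1)) {w} \<union> U)"
  shows "rounds_left G Burner B \<le> k + 2"
proof (cases "pverts G \<subseteq> spread G B")
  case True
  then show ?thesis using rounds_left_le_one[of G B Burner] by simp
next
  case False
  \<comment> \<open>If \<open>w\<close> is still unburned after the spread, Burner selects it;
    otherwise any unburned vertex will do.\<close>
  then obtain v where v: "v \<in> pverts G - spread G B" and "w \<in> insert v (spread G B)"
    using w by blast
  then have "{w} \<subseteq> insert v (spread G B)" by simp
  let ?C = "insert v (spread G B)"
  \<comment> \<open>Two spreads separate \<open>B\<close> from Burner's next turn, but only one
    separates \<open>w\<close>, which burns after the first of them; hence radius
    \<open>k + 1\<close> against \<open>k + 2\<close>.\<close>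
  have "rounds_left G Staller ?C \<le> Suc k"
  proof (rule rounds_left_Staller_le, rule later)
    fix u
    have "(spread G ^^ (k + 2)) B = (spread G ^^ (k + 1)) (spread G B)"
      by (simp add: funpow_swap1)
    also have "\<dots> \<subseteq> (spread G ^^ (k + 1)) ?C"
      by (rule spread_power_mono) auto
    finally have "(spread G ^^ (k + 2)) B \<subseteq> (spread G ^^ (k + 1)) ?C" .
    moreover have "(spread G ^^ (k + 1)) {w} \<subseteq> (spread G ^^ (k + 1)) ?C"
      using \<open>{w} \<subseteq> ?C\<close> by (rule spread_power_mono)
    moreover have "(spread G ^^ (k + 1)) ?C = (spread G ^^ k) (spread G ?C)"
      by (simp add: funpow_swap1)
    moreover have "\<dots> \<subseteq> (spread G ^^ k) (insert u (spread G ?C))"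
      by (rule spread_power_mono) auto
    ultimately show "pverts G \<subseteq> (spread G ^^ k) (insert u (spread G ?C)) \<union> U"
      using cover by blast
  qed
  from rounds_left_Burner_le[OF v this] show ?thesis by simp
qed

lemma game_burning_number_le_radius:
  assumes "w \<in> pverts G" "pverts G \<subseteq> (spread G ^^ r) {w}"
  shows "game_burning_number G \<le> Suc r"
proof -
  have "rounds_left G Staller {w} \<le> r"
    using assms(2) by (rule rounds_left_le_of_spread_power)
  then have "rounds_left G Burner {} \<le> Suc r"
    using assms(1) by (intro rounds_left_Burner_le[of w]) (auto simp: spread_def)
  then show ?thesis
    by (simp add: game_burning_number_def)
qed

lemma game_burning_number_le_three_balls:
  assumes "w1 \<in> pverts G" "w2 \<in> pverts G" "w3 \<in> pverts G"
    and "pverts G \<subseteq> (spread G ^^ (k + 5)) {w1} \<union> (spread G ^^ (k + 3)) {w2} \<union> (spread G ^^ (k + 1)) {w3}"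
  shows "game_burning_number G \<le> k + 6"
proof -
  have 0: "rounds_left G Burner B \<le> k" if "pverts G \<subseteq> (spread G ^^ k) B \<union> {}" for B
    using that by (intro rounds_left_le_of_spread_power) simp
  \<comment> \<open>The game is unrolled from its end: each application puts one more ball into
    \<open>U\<close> and goes back by two rounds, so the radii differ by 2.\<close>
  note 3 = rounds_left_le_add_ball[OF 0 assms(3)]
  note 2 = rounds_left_le_add_ball[OF 3 assms(2)]
  note 1 = rounds_left_le_add_ball[OF 2 assms(1)]
  have "rounds_left G Burner {} \<le> k + 2 + 2 + 2"
    by (rule 1) (use assms(4) in \<open>auto simp: eval_nat_numeral\<close>)
  then show ?thesis
    by (simp add: game_burning_number_def)
qed

section \<open>Covering by balls along a breadth-first search tree\<close>

locale bfs_tree =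
  fixes G :: "'a pair_pre_digraph" and root :: 'a
    and depth :: "'a \<Rightarrow> nat" and parent :: "'a \<Rightarrow> 'a"
  assumes finite_verts: "finite (pverts G)"
    and depth_0: "\<lbrakk>u \<in> pverts G; depth u = 0\<rbrakk> \<Longrightarrow> u = root"
    and parent_arc: "\<lbrakk>u \<in> pverts G; 0 < depth u\<rbrakk> \<Longrightarrow> (parent u, u) \<in> parcs G"
    and parent_vert: "\<lbrakk>u \<in> pverts G; 0 < depth u\<rbrakk> \<Longrightarrow> parent u \<in> pverts G"
    and depth_parent: "\<lbrakk>u \<in> pverts G; 0 < depth u\<rbrakk> \<Longrightarrow> Suc (depth (parent u)) = depth u"
begin

text \<open>Such sets are what remains when whole subtrees are cut off: remaining vertices keep
  their ancestors, so the peeling can be repeated.\<close>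

definition parent_closed :: "'a set \<Rightarrow> bool" where
  "parent_closed A \<longleftrightarrow> A \<subseteq> pverts G \<and> (\<forall>u\<in>A. 0 < depth u \<longrightarrow> parent u \<in> A)"

lemma ancestor:
  assumes "parent_closed A" "u \<in> A" "j \<le> depth u"
  shows "(parent ^^ j) u \<in> A" "depth ((parent ^^ j) u) = depth u - j"
  using assms(3)
proof (induction j)
  case (Suc j)
  { case 1 with Suc assms(1) show ?case by (simp add: parent_closed_def) }
  { case 2
    with Suc have "(parent ^^ j) u \<in> pverts G" "depth ((parent ^^ j) u) = depth u - j"
      using assms(1) by (auto simp: parent_closed_def)
    with depth_parent[of "(parent ^^ j) u"] 2 show ?case by simp }
qed (use assms in auto)

lemma parent_closed_verts: "parent_closed (pverts G)"
  by (simp add: parent_closed_def parent_vert)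

text \<open>The tree path from the ancestor down to \<open>u\<close> is a walk of length
  \<open>j\<close> in \<open>G\<close>.\<close>

lemma in_ball_of_ancestor:
  assumes "u \<in> pverts G" "j \<le> depth u"
  shows "u \<in> (spread G ^^ j) {(parent ^^ j) u}"
  using assms
proof (induction j arbitrary: u)
  case (Suc j)
  then have "parent u \<in> pverts G" "(parent u, u) \<in> parcs G" "j \<le> depth (parent u)"
    using parent_vert[of u] parent_arc[of u] depth_parent[of u] by auto
  with Suc.IH[of "parent u"] Suc.prems show ?case
    by (auto simp: spread_def funpow_swap1)
qed simp

lemma peel_ball_nonempty:
  assumes A: "parent_closed A" and "A \<noteq> {}"
  obtains w A' where "w \<in> pverts G" "parent_closed A'" "A \<subseteq> (spread G ^^ r) {w} \<union> A'"
    "card A' \<le> card A - Suc r"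
proof -
  have AV: "A \<subseteq> pverts G" and fin: "finite A"
    using A finite_verts by (auto simp: parent_closed_def intro: finite_subset)
  obtain v where v: "v \<in> A" and max: "\<And>u. u \<in> A \<Longrightarrow> depth u \<le> depth v"
    using Max_in[of "depth ` A"] Max_ge[of "depth ` A"] fin \<open>A \<noteq> {}\<close> by fastforce
  show ?thesis
  \<comment> \<open>A shallow tree lies in the ball about \<open>root\<close>, and nothing remains;
    otherwise \<open>v\<close> has an ancestor \<open>r\<close> levels up.\<close>
  proof (cases "depth v \<le> r")
    case True
    have "u \<in> (spread G ^^ r) {root}" if "u \<in> A" for u
    proof -
      have "(parent ^^ depth u) u = root"
        using ancestor[OF A that order_refl] AV depth_0 by auto
      with in_ball_of_ancestor[of u "depth u"] that AV
      have "u \<in> (spread G ^^ depth u) {root}" by auto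
      moreover have "depth u \<le> r"
        using max[OF that] True by simp
      ultimately show ?thesis
        using spread_power_le[of "depth u" r G "{root}"] by blast
    qed
    moreover have "root \<in> pverts G"
      using ancestor[OF A v order_refl] AV depth_0 by auto
    ultimately show ?thesis
      by (intro that[of root "{}"]) (auto simp: parent_closed_def)
  next
    case False
    define w where "w = (parent ^^ r) v"
    \<comment> \<open>The descendants of \<open>w\<close> in \<open>A\<close>, including
      \<open>w\<close>: climbing from them to the level of \<open>w\<close> ends at
      \<open>w\<close>.\<close>
    define S where "S = {u \<in> A. depth w \<le> depth u \<and> (parent ^^ (depth u - depth w)) u = w}"
    have w: "w \<in> pverts G" and depth_w: "depth w = depth v - r"
      using ancestor[OF A v, of r] False AV by (auto simp: w_def)
    have "u \<in> (spread G ^^ r) {w}" if "u \<in> S" for u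
    proof -
      have "u \<in> (spread G ^^ (depth u - depth w)) {w}"
        using in_ball_of_ancestor[of u "depth u - depth w"] that AV by (auto simp: S_def)
      moreover have "depth u - depth w \<le> r"
        using max[of u] that depth_w by (auto simp: S_def)
      ultimately show ?thesis
        using spread_power_le[of "depth u - depth w" r G "{w}"] by blast
    qed
    moreover have "parent_closed (A - S)"
      unfolding parent_closed_def
    proof (intro conjI ballI impI DiffI)
      show "A - S \<subseteq> pverts G" using AV by auto
      fix u assume u: "u \<in> A - S" "0 < depth u"
      then show "parent u \<in> A" using A by (auto simp: parent_closed_def)
      have "depth u = Suc (depth (parent u))" using depth_parent[of u] u AV by auto
      \<comment> \<open>If the climb from the parent of \<open>u\<close> ended at \<open>w\<close>,
        so would the climb from \<open>u\<close>, which is one step longer.\<close>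
      then show "parent u \<notin> S"
        using u by (auto simp: S_def Suc_diff_le funpow_swap1)
    qed
    moreover have "card (A - S) \<le> card A - Suc r"
    proof -
      have depth_i: "depth ((parent ^^ i) v) = depth v - i" if "i \<le> r" for i
        using ancestor(2)[OF A v, of i] that False by simp
      \<comment> \<open>The path from \<open>v\<close> up to \<open>w\<close> supplies
        \<open>r + 1\<close> vertices of \<open>S\<close>. They are distinct because their depths
        \<open>depth v - i\<close> differ; \<open>r < depth v\<close> keeps this subtraction
        exact.\<close>
      have "inj_on (\<lambda>i. (parent ^^ i) v) {..r}"
      proof (rule inj_onI)
        fix i j assume "i \<in> {..r}" "j \<in> {..r}" "(parent ^^ i) v = (parent ^^ j) v"
        with depth_i[of i] depth_i[of j] False show "i = j" by auto
      qed
      moreover have "(parent ^^ i) v \<in> S" if "i \<le> r" for i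
      proof -
        have "(parent ^^ (r - i)) ((parent ^^ i) v) = w"
          using that by (simp add: w_def flip: funpow_add comp_apply[of "parent ^^ _"])
        moreover have "depth ((parent ^^ i) v) - depth w = r - i"
          using depth_i[OF that] depth_w that False by simp
        ultimately show ?thesis
          using ancestor(1)[OF A v, of i] depth_i[OF that] depth_w that False by (simp add: S_def)
      qed
      moreover have "finite S" using fin by (simp add: S_def)
      ultimately have "card {..r} \<le> card S"
        by (intro card_inj_on_le) auto
      moreover have "card (A - S) = card A - card S"
        using \<open>finite S\<close> by (intro card_Diff_subset) (auto simp: S_def)
      ultimately show ?thesis by simp
    qed
    ultimately show ?thesis
      using w by (intro that[of w "A - S"]) auto
  qed
qed

text \<open>Allowing an empty \<open>A\<close> lets the peeling go on, with an arbitrary centre,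
  when the tree is exhausted before all balls are used.\<close>

lemma peel_ball:
  assumes "parent_closed A" "pverts G \<noteq> {}"
  obtains w A' where "w \<in> pverts G" "parent_closed A'" "A \<subseteq> (spread G ^^ r) {w} \<union> A'"
    "card A' \<le> card A - Suc r"
proof (cases "A = {}")
  case True
  with assms that[of _ "{}"] show ?thesis by auto
next
  case False
  with assms(1) show ?thesis by (rule peel_ball_nonempty) (rule that)
qed

lemma game_burning_number_le:
  assumes "pverts G \<noteq> {}"
  shows "game_burning_number G \<le> card (pverts G) div 3 + 6"
proof -
  let ?k = "card (pverts G) div 3"
  note peel = peel_ball[OF _ assms]
  obtain w1 A1 where 1: "w1 \<in> pverts G" "parent_closed A1"
    "pverts G \<subseteq> (spread G ^^ (?k + 5)) {w1} \<union> A1" "card A1 \<le> card (pverts G) - Suc (?k + 5)"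
    using peel[OF parent_closed_verts] by metis
  obtain w2 A2 where 2: "w2 \<in> pverts G" "parent_closed A2"
    "A1 \<subseteq> (spread G ^^ (?k + 3)) {w2} \<union> A2" "card A2 \<le> card A1 - Suc (?k + 3)"
    using peel[OF 1(2)] by metis
  obtain w3 A3 where 3: "w3 \<in> pverts G" "parent_closed A3"
    "A2 \<subseteq> (spread G ^^ (?k + 1)) {w3} \<union> A3" "card A3 \<le> card A2 - Suc (?k + 1)"
    using peel[OF 2(2)] by metis
  \<comment> \<open>The three balls account for
    \<open>(?k + 6) + (?k + 4) + (?k + 2) = 3 * ?k + 12\<close> vertices, while the graph has at
    most \<open>3 * ?k + 2\<close>.\<close>
  have "card A3 = 0"
    using 1(4) 2(4) 3(4) by linarith
  moreover have "finite A3"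
    using 3(2) finite_verts by (auto simp: parent_closed_def intro: finite_subset)
  ultimately have "A3 = {}" by simp
  with 1 2 3 show ?thesis
    by (intro game_burning_number_le_three_balls[of w1 G w2 w3]) auto
qed

end

section \<open>Connected graphs\<close>

lemma (in pair_graph) in_spread_power_of_reachable:
  assumes "Digraph_Component.connected (with_proj G)" "x \<in> pverts G" "v \<in> pverts G"
  shows "\<exists>r. v \<in> (spread G ^^ r) {x}"
proof -
  \<comment> \<open>\<open>connected\<close> speaks of the symmetric closure; since the arcs are
    symmetric, it yields directed reachability.\<close>
  have "strongly_connected (with_proj G)"
    using assms(1) pair_sym_arcs by (intro symmetric_connected_imp_strongly_connected)
  then have "x \<rightarrow>\<^sup>*\<^bsub>with_proj G\<^esub> v"
    using assms(2,3) by auto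
  then show ?thesis
  proof (induction rule: reachable_induct)
    case base
    have "x \<in> (spread G ^^ 0) {x}" by simp
    then show ?case by blast
  next
    case (step u v)
    then obtain r where "u \<in> (spread G ^^ r) {x}" by blast
    with step have "v \<in> (spread G ^^ Suc r) {x}"
      by (auto simp: spread_def dest: in_arcsD2)
    then show ?case by blast
  qed
qed

text \<open>\<open>depth\<close> is the distance from \<open>x\<close>, taken as the least number of
  spreads that reach a vertex; a parent is a neighbour reached one spread earlier.\<close>

lemma (in pair_graph) obtain_bfs_tree:
  assumes "Digraph_Component.connected (with_proj G)" "x \<in> pverts G"
  obtains depth parent where "bfs_tree G x depth parent"
proof -
  define depth where "depth v = (LEAST r. v \<in> (spread G ^^ r) {x})" for v
  have depth: "v \<in> (spread G ^^ depth v) {x}" if "v \<in> pverts G" for v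
    unfolding depth_def using in_spread_power_of_reachable[OF assms that] by (rule LeastI_ex)
  have depth_le: "depth v \<le> r" if "v \<in> (spread G ^^ r) {x}" for v r
    unfolding depth_def using that by (rule Least_le)
  have "\<exists>u. u \<in> pverts G \<and> (u, v) \<in> parcs G \<and> Suc (depth u) = depth v"
    if v: "v \<in> pverts G" "0 < depth v" for v
  proof -
    obtain r where r: "depth v = Suc r"
      using v(2) gr0_implies_Suc by blast
    have "v \<notin> (spread G ^^ r) {x}"
      using depth_le[of v r] r by auto
    with depth[OF v(1)] obtain u where u: "u \<in> (spread G ^^ r) {x}" "(u, v) \<in> parcs G"
      by (auto simp: r spread_def)
    have "u \<in> pverts G"
      using in_arcsD1 u(2) by simp
    \<comment> \<open>\<open>u\<close> is reached within \<open>r\<close> spreads, so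
      \<open>depth u \<le> r\<close>; conversely \<open>v\<close> is reached one spread after
      \<open>u\<close>, which excludes \<open>depth u < r\<close>.\<close>
    have "v \<in> (spread G ^^ Suc (depth u)) {x}"
      using depth[OF \<open>u \<in> pverts G\<close>] u(2) v(1) by (auto simp: spread_def)
    from depth_le[OF this] depth_le[OF u(1)] r have "Suc (depth u) = depth v"
      by simp
    with u \<open>u \<in> pverts G\<close> show ?thesis by blast
  qed
  then obtain parent where "\<And>v. v \<in> pverts G \<Longrightarrow> 0 < depth v \<Longrightarrow>
      parent v \<in> pverts G \<and> (parent v, v) \<in> parcs G \<and> Suc (depth (parent v)) = depth v"
    by metis
  moreover have "v = x" if "v \<in> pverts G" "depth v = 0" for v
    using depth[OF that(1)] that(2) by simp
  ultimately have "bfs_tree G x depth parent"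
    by unfold_locales auto
  then show ?thesis by (rule that)
qed

lemma game_burning_number_le_of_connected:
  assumes "pair_graph G" "Digraph_Component.connected (with_proj G)" "pverts G \<noteq> {}"
  shows "game_burning_number G \<le> card (pverts G) div 3 + 6"
proof -
  obtain x where "x \<in> pverts G" using assms(3) by blast
  then obtain depth parent where "bfs_tree G x depth parent"
    using pair_graph.obtain_bfs_tree[OF assms(1,2)] by blast
  then show ?thesis
    using assms(3) by (rule bfs_tree.game_burning_number_le)
qed

section \<open>Passing to the complement and bounding the product\<close>

lemma complement_radius_le_2:
  assumes "pair_graph G" "x \<in> pverts G" "y \<in> pverts G" "y \<notin> (spread G ^^ 2) {x}"
  shows "pverts G \<subseteq> (spread (complement_graph G) ^^ 2) {x}"
proof
  interpret pair_graph G by (rule assms)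
  have sym: "(v, u) \<in> parcs G" if "(u, v) \<in> parcs G" for u v
    using that pair_sym_arcs by (auto simp: symmetric_def sym_def)
  fix v assume v: "v \<in> pverts G"
  let ?H = "complement_graph G"
  have far: "y \<noteq> x" "(x, y) \<notin> parcs G" "\<And>u. (x, u) \<in> parcs G \<Longrightarrow> (u, y) \<notin> parcs G"
    using assms(2-4) in_arcsD2 by (auto simp: eval_nat_numeral spread_def)
  show "v \<in> (spread ?H ^^ 2) {x}"
  proof (cases "v = x \<or> (x, v) \<notin> parcs G")
    case True
    then show ?thesis
      using v assms(2) by (auto simp: eval_nat_numeral spread_def complement_graph_def)
  next
    case False
    \<comment> \<open>Here \<open>v\<close> is a neighbour of \<open>x\<close> in \<open>G\<close>,
      hence not of \<open>y\<close>, so \<open>x\<close>, \<open>y\<close>, \<open>v\<close> is a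
      path in the complement.\<close>
    with far sym have "(x, y) \<in> parcs ?H" "(y, v) \<in> parcs ?H"
      using v assms(2,3) by (auto simp: complement_graph_def)
    then show ?thesis
      using v assms(3) by (auto simp: eval_nat_numeral spread_def complement_graph_def)
  qed
qed

theorem corollary12:
  fixes G :: "'a pair_pre_digraph" and n :: nat
  assumes "pair_graph G"
    and "card (pverts G) = n" and "n \<ge> 3"
    and "Digraph_Component.connected (with_proj G)"
    and "Digraph_Component.connected (with_proj (complement_graph G))"
  shows "game_burning_number G * game_burning_number (complement_graph G) \<le> n + 18"
proof -
  let ?H = "complement_graph G"
  have verts_H: "pverts ?H = pverts G"
    by (simp add: complement_graph_def)
  have "pverts G \<noteq> {}"
    using assms(2,3) by auto
  then obtain x where x: "x \<in> pverts G" by blast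
  have G: "game_burning_number G \<le> n div 3 + 6"
    using game_burning_number_le_of_connected[OF assms(1,4)] \<open>pverts G \<noteq> {}\<close> assms(2) by simp
  have H: "game_burning_number ?H \<le> n div 3 + 6"
    using game_burning_number_le_of_connected[OF pair_graph_complement_graph[OF assms(1)] assms(5)]
      \<open>pverts G \<noteq> {}\<close> assms(2) by (simp add: verts_H)
  \<comment> \<open>The constant 18 is the additive 6 of one factor times the bound 3 on the
    other.\<close>
  have "(n div 3 + 6) * 3 \<le> n + 18"
    by simp
  moreover have "game_burning_number G * game_burning_number ?H \<le> (n div 3 + 6) * 3"
  \<comment> \<open>The centre \<open>x\<close> is arbitrary: if its ball of radius 2 misses a
    vertex of \<open>G\<close>, the same \<open>x\<close> serves as centre in the
    complement.\<close>
  proof (cases "pverts G \<subseteq> (spread G ^^ 2) {x}")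
    case True
    from game_burning_number_le_radius[OF x this]
    have "game_burning_number G * game_burning_number ?H \<le> 3 * (n div 3 + 6)"
      using H by (intro mult_le_mono) auto
    then show ?thesis by (simp only: mult.commute)
  next
    case False
    then obtain y where "y \<in> pverts G" "y \<notin> (spread G ^^ 2) {x}" by blast
    from complement_radius_le_2[OF assms(1) x this] have "game_burning_number ?H \<le> 3"
      using game_burning_number_le_radius[of x ?H 2] x by (simp add: verts_H)
    with G show ?thesis by (rule mult_le_mono)
  qed
  ultimately show ?thesis by (rule order_trans[rotated])
qed

end
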